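(* Let $\kappa$ be an infinite regular cardinal. If $\mathfrak{B}$ is a Boolean algebra of cardinality $\kappa$ and $\mathfrak{B}$ has the subsequential completeness property (SCP), then $\mathfrak{B}$ is not $\kappa$-Corson.
   Context: A Boolean algebra $\mathfrak{B}$ has the subsequential completeness property (SCP) if for any sequence $(a_n)_{n\in\omega}$ of pairwise disjoint elements of $\mathfrak{B}$ there is an infinite $N\subseteq\omega$ such that the family $\{a_n:n\in N\}$ has a least upper bound in $\mathfrak{B}$. For an infinite cardinal $\kappa$ and a set $\Gamma$, $\Sigma_\kappa(\mathbb{R}^\Gamma)=\{x\in\mathbb{R}^\Gamma:\ |\{\gamma\in\Gamma:x(\gamma)\neq0\}|<\kappa\}$ with the topology inherited from the product. A compact (Hausdorff) space is $\kappa$-Corson compact if it is homeomorphic to a subset of $\Sigma_\kappa(\mathbb{R}^\Gamma)$ for some set $\Gamma$. A Boolean algebra is $\kappa$-Corson if its Stone space (of ultrafilters) is $\kappa$-Corson compact. *)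

theory Defs
  imports "HOL-Analysis.Analysis" "HOL-Library.Lub_Glb"
begin

unbundle cardinal_syntax

definition SCP :: "'a::boolean_algebra itself \<Rightarrow> bool" where
  "SCP _ \<longleftrightarrow> (\<forall>a :: nat \<Rightarrow> 'a. (\<forall>m n. m \<noteq> n \<longrightarrow> inf (a m) (a n) = bot) \<longrightarrow>
     (\<exists>N. infinite N \<and> (\<exists>s. isLub UNIV (a ` N) s)))"

definition proper_filter :: "'a::boolean_algebra set \<Rightarrow> bool" where
  "proper_filter F \<longleftrightarrow> top \<in> F \<and> bot \<notin> F \<and>
     (\<forall>a\<in>F. \<forall>b\<in>F. inf a b \<in> F) \<and> (\<forall>a\<in>F. \<forall>b. a \<le> b \<longrightarrow> b \<in> F)"

definition ultrafilter :: "'a::boolean_algebra set \<Rightarrow> bool" where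
  "ultrafilter U \<longleftrightarrow> proper_filter U \<and> (\<forall>F. proper_filter F \<and> U \<subseteq> F \<longrightarrow> F = U)"

(* The underlying set is the set of all ultrafilters, namely the generating set for a = top. *)
definition stone_space :: "'a::boolean_algebra set topology" where
  "stone_space = topology_generated_by (range (\<lambda>a. {U. ultrafilter U \<and> a \<in> U}))"

(* As everywhere below, the cardinal is represented by a cardinal order (a well-order of minimal
   order type) on an arbitrary type 'k. *)
definition Sigma_set :: "'k rel \<Rightarrow> 'g set \<Rightarrow> ('g \<Rightarrow> real) set" where
  "Sigma_set \<kappa> \<Gamma> = {x \<in> \<Gamma> \<rightarrow>\<^sub>E UNIV. |{\<gamma> \<in> \<Gamma>. x \<gamma> \<noteq> 0}| <o \<kappa>}"

definition Sigma_space :: "'k rel \<Rightarrow> 'g set \<Rightarrow> ('g \<Rightarrow> real) topology" where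
  "Sigma_space \<kappa> \<Gamma> = subtopology (product_topology (\<lambda>_. euclideanreal) \<Gamma>) (Sigma_set \<kappa> \<Gamma>)"

(* HOL cannot quantify over types inside a formula, so the index sets \<Gamma> range over the subsets of
   the type passed as first argument. A space fails to be Corson in the set-theoretic sense iff
   the predicate fails for every type 'g, which a theorem expresses by leaving 'g free. *)
definition Corson_compact :: "'g itself \<Rightarrow> 'k rel \<Rightarrow> 'b topology \<Rightarrow> bool" where
  "Corson_compact _ \<kappa> X \<longleftrightarrow> compact_space X \<and> Hausdorff_space X \<and>
     (\<exists>(\<Gamma> :: 'g set) S. S \<subseteq> Sigma_set \<kappa> \<Gamma> \<and>
        X homeomorphic_space subtopology (Sigma_space \<kappa> \<Gamma>) S)"

definition Corson_algebra :: "'g itself \<Rightarrow> 'k rel \<Rightarrow> 'a::boolean_algebra itself \<Rightarrow> bool" where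
  "Corson_algebra G \<kappa> _ \<longleftrightarrow> Corson_compact G \<kappa> (stone_space :: 'a set topology)"

end

theory Submission
  imports Defs
begin

text \<open>
Write \<open>K\<close> for the Stone space, viewed as a compact subset of a \<open>\<Sigma>\<close>-product.
By the SCP, an almost disjoint family of size continuum yields uncountably many clopen sets, so
\<open>\<kappa>\<close> is uncountable, and \<open>K\<close> has no nontrivial convergent sequences.
By regularity of \<open>\<kappa>\<close>, every small set of coordinates is contained in a small set \<open>\<Delta>\<close> such that
\<open>K\<close> is closed under setting all coordinates outside \<open>\<Delta>\<close> to zero. As \<open>K\<close> has \<open>\<kappa>\<close> many clopen
sets, there are an increasing sequence of such \<open>\<Delta>\<^sub>n\<close>, with retractions \<open>r\<^sub>n\<close> of \<open>K\<close>
converging pointwise to the retraction \<open>r\<close> that belongs to \<open>\<Union>\<Delta>\<^sub>n\<close>, and points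
\<open>x\<^sub>n \<in> K\<close> fixed by \<open>r\<^sub>m\<close> for \<open>m > n\<close> but not by \<open>r\<^sub>n\<close>. Passing to a
subsequence, the \<open>x\<^sub>n\<close> have pairwise disjoint clopen neighbourhoods \<open>b\<^sub>n\<close> without fixed
points of \<open>r\<^sub>n\<close>.

The SCP gives an almost disjoint family of infinite sets \<open>N\<^sub>A\<close> such that
\<open>{b\<^sub>n : n \<in> N\<^sub>A}\<close> has a supremum \<open>s\<^sub>A\<close>. Let \<open>y\<close> be an accumulation point of
\<open>{x\<^sub>n : n \<in> N\<^sub>A}\<close>. Then \<open>r\<^sub>n y\<close> converges to \<open>r y = y\<close>, so \<open>r\<^sub>n y = y\<close> for some \<open>n\<close>, and
by continuity of \<open>r\<^sub>n\<close> some \<open>r\<^sub>n x\<^sub>m\<close> lies in \<open>s\<^sub>A\<close> but in none of the \<open>b\<^sub>i\<close>.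
The sets \<open>s\<^sub>A - \<Union>b\<^sub>i\<close> are pairwise disjoint, so \<open>(n, m)\<close> determines \<open>A\<close>, although there
are uncountably many \<open>A\<close>.
\<close>

section \<open>Compact spaces with subsequentially complete clopen algebra\<close>

text \<open>In the last assumption, \<open>s\<close> is the least upper bound of the \<open>b n\<close> among the clopen sets;
leastness is tested against the complements \<open>c\<close> of upper bounds.\<close>

locale scp_space =
  fixes X :: "'a topology"
  assumes compact: "compact_space X"
    and Hausdorff: "Hausdorff_space X"
    and clopen_base: "\<And>W x. openin X W \<Longrightarrow> x \<in> W \<Longrightarrow>
          \<exists>C. openin X C \<and> closedin X C \<and> x \<in> C \<and> C \<subseteq> W"
    and scp: "\<And>b :: nat \<Rightarrow> 'a set. (\<And>n. openin X (b n)) \<Longrightarrow> (\<And>n. closedin X (b n)) \<Longrightarrow>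
          (\<And>m n. m \<noteq> n \<Longrightarrow> b m \<inter> b n = {}) \<Longrightarrow>
          \<exists>N s. infinite N \<and> openin X s \<and> closedin X s \<and> (\<forall>n\<in>N. b n \<subseteq> s) \<and>
            (\<forall>c. openin X c \<longrightarrow> closedin X c \<longrightarrow> (\<forall>n\<in>N. c \<inter> b n = {}) \<longrightarrow> c \<inter> s = {})"

definition disjoint_clopens :: "'a topology \<Rightarrow> (nat \<Rightarrow> 'a set) \<Rightarrow> bool" where
  "disjoint_clopens X b \<longleftrightarrow> (\<forall>n. openin X (b n) \<and> closedin X (b n)) \<and>
     (\<forall>m n. m \<noteq> n \<longrightarrow> b m \<inter> b n = {})"

text \<open>\<open>M A\<close> consists of the codes of the finite initial segments of
  \<open>A\<close>; two sets share only segments that end before an index where they differ.\<close>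

lemma almost_disjoint_family:
  "\<exists>M :: nat set \<Rightarrow> nat set. (\<forall>A. infinite (M A)) \<and> (\<forall>A B. A \<noteq> B \<longrightarrow> finite (M A \<inter> M B))"
proof (intro exI conjI allI impI)
  define code :: "nat set \<Rightarrow> nat \<Rightarrow> nat"
    where "code A n = to_nat (map (\<lambda>i. i \<in> A) [0..<n])" for A n
  have code_eq: "m = n \<and> (\<forall>i<n. i \<in> A \<longleftrightarrow> i \<in> B)" if "code A m = code B n" for A B m n
  proof -
    have eq: "map (\<lambda>i. i \<in> A) [0..<m] = map (\<lambda>i. i \<in> B) [0..<n]"
      using that by (simp add: code_def)
    then have "m = n"
      by (metis length_map length_upt minus_nat.diff_0)
    with eq show ?thesis
      by simp
  qed
  show "infinite (range (code A))" for A
    using code_eq by (intro range_inj_infinite injI) blast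
  show "finite (range (code A) \<inter> range (code B))" if ne: "A \<noteq> B" for A B
  proof -
    obtain i where i: "(i \<in> A) \<noteq> (i \<in> B)"
      using ne by blast
    have "range (code A) \<inter> range (code B) \<subseteq> code A ` {..i}"
    proof
      fix x assume "x \<in> range (code A) \<inter> range (code B)"
      then obtain m n where x: "x = code A m" "x = code B n"
        by blast
      then have "m = n \<and> (\<forall>i<n. i \<in> A \<longleftrightarrow> i \<in> B)"
        using code_eq by metis
      with i have "m \<le> i"
        by (metis not_le)
      with x show "x \<in> code A ` {..i}"
        by blast
    qed
    then show ?thesis
      by (meson finite_atMost finite_imageI finite_subset)
  qed
qed

lemma uncountable_nat_sets: "uncountable (UNIV :: nat set set)"
  using Cantors_theorem[of "UNIV :: nat set"] by (auto simp: uncountable_def)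

section \<open>Disjoint clopen sequences, their suprema and accumulation points\<close>

context scp_space
begin

lemma scp_infinite:
  assumes b: "disjoint_clopens X b" and M: "infinite M"
  shows "\<exists>N s. N \<subseteq> M \<and> infinite N \<and> openin X s \<and> closedin X s \<and> (\<forall>n\<in>N. b n \<subseteq> s) \<and>
    (\<forall>c. openin X c \<longrightarrow> closedin X c \<longrightarrow> (\<forall>n\<in>N. c \<inter> b n = {}) \<longrightarrow> c \<inter> s = {})"
proof -
  obtain r :: "nat \<Rightarrow> nat" where r: "strict_mono r" "\<And>n. r n \<in> M"
    using infinite_enumerate[OF M] by blast
  have inj: "inj r"
    using r(1) by (rule strict_mono_imp_inj_on)
  have "\<exists>N s. infinite N \<and> openin X s \<and> closedin X s \<and> (\<forall>n\<in>N. b (r n) \<subseteq> s) \<and>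
            (\<forall>c. openin X c \<longrightarrow> closedin X c \<longrightarrow> (\<forall>n\<in>N. c \<inter> b (r n) = {}) \<longrightarrow> c \<inter> s = {})"
    using b inj by (intro scp) (auto simp: disjoint_clopens_def inj_eq)
  then obtain N s where N: "infinite N" "openin X s" "closedin X s" "\<forall>n\<in>N. b (r n) \<subseteq> s"
      "\<forall>c. openin X c \<longrightarrow> closedin X c \<longrightarrow> (\<forall>n\<in>N. c \<inter> b (r n) = {}) \<longrightarrow> c \<inter> s = {}"
    by blast
  have "infinite (r ` N)"
    using N(1) inj by (meson finite_imageD inj_on_subset subset_UNIV)
  with N r show ?thesis
    by (intro exI[of _ "r ` N"] exI[of _ s]) auto
qed

text \<open>By leastness \<open>s B\<close> misses each \<open>b n\<close> with \<open>n\<close>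
  outside \<open>N B\<close>. After removal of the finitely many common \<open>b n\<close>, the
  intersection thus misses all \<open>b n\<close> with \<open>n \<in> N A\<close>, and hence
  \<open>s A\<close>.\<close>

lemma almost_disjoint_suprema:
  assumes b: "disjoint_clopens X b"
  shows "\<exists>(N :: nat set \<Rightarrow> nat set) s. \<forall>A. infinite (N A) \<and> openin X (s A) \<and> closedin X (s A) \<and>
    (\<forall>n\<in>N A. b n \<subseteq> s A) \<and> (\<forall>B. A \<noteq> B \<longrightarrow> s A \<inter> s B \<subseteq> (\<Union>n. b n))"
proof -
  obtain M :: "nat set \<Rightarrow> nat set"
    where M: "\<And>A. infinite (M A)" "\<And>A B. A \<noteq> B \<Longrightarrow> finite (M A \<inter> M B)"
    using almost_disjoint_family by auto
  have "\<exists>N s. N \<subseteq> M A \<and> infinite N \<and> openin X s \<and> closedin X s \<and> (\<forall>n\<in>N. b n \<subseteq> s) \<and>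
     (\<forall>c. openin X c \<longrightarrow> closedin X c \<longrightarrow> (\<forall>n\<in>N. c \<inter> b n = {}) \<longrightarrow> c \<inter> s = {})" for A
    by (rule scp_infinite[OF b M(1)])
  then obtain N s where N: "\<And>A. N A \<subseteq> M A" "\<And>A. infinite (N A)" "\<And>A. openin X (s A)"
      "\<And>A. closedin X (s A)" "\<And>A. (\<forall>n\<in>N A. b n \<subseteq> s A)"
      and sup: "\<And>A c. openin X c \<Longrightarrow> closedin X c \<Longrightarrow> (\<forall>n\<in>N A. c \<inter> b n = {}) \<Longrightarrow> c \<inter> s A = {}"
    by metis
  have "s A \<inter> s B \<subseteq> (\<Union>n. b n)" if "A \<noteq> B" for A B
  proof -
    have fin: "finite (N A \<inter> N B)"
      using M(2)[OF that] N(1) by (meson Int_mono finite_subset)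
    \<comment> \<open>Finiteness of \<open>N A \<inter> N B\<close> keeps this set clopen, so that
      leastness of \<open>s A\<close> can be tested against it.\<close>
    define c where "c = s A \<inter> s B - (\<Union>n\<in>N A \<inter> N B. b n)"
    have c: "openin X c" "closedin X c"
      unfolding c_def using b N fin
      by (auto simp: disjoint_clopens_def intro!: openin_diff closedin_diff closedin_Union openin_Union)
    have "c \<inter> b n = {}" if n: "n \<in> N A" for n
    proof (cases "n \<in> N B")
      case True
      with n show ?thesis
        by (auto simp: c_def)
    next
      case False
      then have "\<forall>m\<in>N B. b n \<inter> b m = {}"
        using b by (metis disjoint_clopens_def)
      then have "b n \<inter> s B = {}"
        using b by (intro sup) (auto simp: disjoint_clopens_def)
      then show ?thesis
        by (auto simp: c_def)
    qed
    then have "c \<inter> s A = {}"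
      using c by (intro sup) auto
    then show ?thesis
      by (auto simp: c_def)
  qed
  with N show ?thesis
    by (intro exI[of _ N] exI[of _ s]) auto
qed

text \<open>Each \<open>b n\<close> is open and contains only the term \<open>x n\<close>, so no
  accumulation point lies in it.\<close>

lemma accumulation_point:
  fixes b :: "nat \<Rightarrow> 'a set"
  assumes b: "disjoint_clopens X b" and x: "\<And>n. x n \<in> b n" and N: "infinite N"
  obtains y where "y \<in> topspace X" "y \<notin> (\<Union>n. b n)"
    "\<And>W. openin X W \<Longrightarrow> y \<in> W \<Longrightarrow> \<exists>m\<in>N. x m \<in> W"
proof -
  have xX: "x n \<in> topspace X" for n
    using b x by (meson disjoint_clopens_def openin_subset subsetD)
  have disj: "m = n" if "x m \<in> b n" for m n
    using b x that unfolding disjoint_clopens_def by blast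
  have "inj x"
    using disj x by (metis injI)
  then have "infinite (x ` N)"
    using N by (meson finite_imageD inj_on_subset subset_UNIV)
  then obtain y where y: "y \<in> X derived_set_of (x ` N)"
    using compact_space_imp_Bolzano_Weierstrass[OF compact, of "x ` N"] xX by blast
  then have yX: "y \<in> topspace X"
    by (simp add: in_derived_set_of)
  have inf: "infinite (x ` N \<inter> W)" if "openin X W" "y \<in> W" for W
    using y that by (auto simp: derived_set_of_infinite_openin[OF Hausdorff])
  have "y \<notin> b n" for n
  proof
    assume "y \<in> b n"
    then have "infinite (x ` N \<inter> b n)"
      using b inf by (simp add: disjoint_clopens_def)
    moreover have "x ` N \<inter> b n \<subseteq> {x n}"
      using disj by blast
    ultimately show False
      using finite_subset by blast
  qed
  moreover have "\<exists>m\<in>N. x m \<in> W" if "openin X W" "y \<in> W" for W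
  proof -
    have "x ` N \<inter> W \<noteq> {}"
      using inf[OF that] by (metis finite.emptyI)
    then show ?thesis
      by blast
  qed
  ultimately show thesis
    using yX that by blast
qed

text \<open>Terms and neighbourhoods are chosen recursively, all avoiding one fixed accumulation
  point. The sets \<open>V n\<close> carry any further property that the neighbourhoods shall
  have.\<close>

lemma disjoint_clopen_neighbourhoods:
  fixes f :: "nat \<Rightarrow> 'a"
  assumes f: "infinite (range f)" and V: "\<And>n. openin X (V n)" "\<And>n. f n \<in> V n"
  obtains k b where "strict_mono k" "disjoint_clopens X b" "\<And>i. f (k i) \<in> b i" "\<And>i. b i \<subseteq> V (k i)"
proof -
  have fX: "f n \<in> topspace X" for n
    using V by (meson openin_subset subsetD)
  obtain y where y: "y \<in> X derived_set_of (range f)"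
    using compact_space_imp_Bolzano_Weierstrass[OF compact, of "range f"] fX f by blast
  then have yX: "y \<in> topspace X"
    by (simp add: in_derived_set_of)
  have ex: "\<exists>k>m. f k \<in> W \<and> f k \<noteq> y" if "openin X W" "y \<in> W" for m W
  proof -
    have "infinite (range f \<inter> W)"
      using y that by (auto simp: derived_set_of_infinite_openin[OF Hausdorff])
    \<comment> \<open>Dropping the first terms forces a later index; dropping \<open>y\<close>
      allows the chosen term to be separated from it.\<close>
    then have "infinite (range f \<inter> W - f ` {..m} - {y})"
      by (intro infinite_remove Diff_infinite_finite) auto
    then have "range f \<inter> W - f ` {..m} - {y} \<noteq> {}"
      by (metis finite.emptyI)
    then obtain k where "f k \<in> W" "f k \<notin> f ` {..m}" "f k \<noteq> y"
      by blast
    then show ?thesis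
      by (metis atMost_iff imageI not_le)
  qed
  \<comment> \<open>In a triple \<open>(k, c, u)\<close>, \<open>u\<close> contains all clopen sets chosen so far; as it misses the accumulation
    point \<open>y\<close>, infinitely many terms of the sequence remain outside of it.\<close>
  define P where "P = (\<lambda>(k, c, u). f k \<in> c \<and> c \<subseteq> V k \<and> openin X c \<and> closedin X c \<and>
      openin X u \<and> closedin X u \<and> c \<subseteq> u \<and> y \<notin> u)"
  define Q where "Q = (\<lambda>(k :: nat, c :: 'a set, u :: 'a set) (k', c' :: 'a set, u').
      k < k' \<and> c' \<inter> u = {} \<and> u \<subseteq> u')"
  have step: "\<exists>t'. P t' \<and> Q (m, c, u) t'" if u: "openin X u" "closedin X u" "y \<notin> u" for m c u
  proof -
    obtain k where k: "m < k" "f k \<in> topspace X - u" "f k \<noteq> y"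
      using ex[of "topspace X - u" m] u yX by blast
    have "openin X ((topspace X - u) \<inter> V k - {y})"
      using u V(1) yX Hausdorff by (intro openin_diff openin_Int) (auto simp: closedin_Hausdorff_singleton)
    then obtain c' where c': "openin X c'" "closedin X c'" "f k \<in> c'"
        "c' \<subseteq> (topspace X - u) \<inter> V k - {y}"
      using clopen_base[of "(topspace X - u) \<inter> V k - {y}" "f k"] k V(2) by blast
    then have "P (k, c', u \<union> c')" "Q (m, c, u) (k, c', u \<union> c')"
      using u k by (auto simp: P_def Q_def)
    then show ?thesis
      by blast
  qed
  have "\<exists>t'. P t' \<and> Q t t'" if "P t" for t
  proof -
    obtain k c u where t: "t = (k, c, u)"
      by (rule prod_cases3)
    with \<open>P t\<close> have "openin X u" "closedin X u" "y \<notin> u"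
      by (auto simp: P_def)
    then show ?thesis
      unfolding t by (rule step)
  qed
  \<comment> \<open>This triple violates \<open>P\<close>, its second component being empty, but the
    step only asks that the third be clopen and miss \<open>y\<close>.\<close>
  moreover have "\<exists>t'. P t' \<and> Q (0, {}, {}) t'"
    by (rule step) auto
  ultimately have "\<exists>t. \<forall>n. P (t n) \<and> Q (t n) (t (Suc n))"
    by (intro dependent_nat_choice) blast+
  then obtain t where t: "\<And>n. P (t n)" "\<And>n. Q (t n) (t (Suc n))"
    by blast
  define k where "k n = fst (t n)" for n
  define b where "b n = fst (snd (t n))" for n
  define u where "u n = snd (snd (t n))" for n
  have teq: "t n = (k n, b n, u n)" for n
    by (simp add: k_def b_def u_def)
  have P: "f (k n) \<in> b n" "b n \<subseteq> V (k n)" "openin X (b n)" "closedin X (b n)" "b n \<subseteq> u n" for n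
    using t(1)[of n] by (auto simp: P_def teq)
  have Q: "k n < k (Suc n)" "b (Suc n) \<inter> u n = {}" "u n \<subseteq> u (Suc n)" for n
    using t(2)[of n] by (auto simp: Q_def teq)
  have mono: "u m \<subseteq> u n" if "m \<le> n" for m n
    using that Q(3) by (rule lift_Suc_mono_le[rotated])
  have disj: "b m \<inter> b n = {}" if "m < n" for m n
  proof -
    obtain j where j: "n = Suc j" "m \<le> j"
      using \<open>m < n\<close> by (cases n) auto
    then show ?thesis
      using P(5)[of m] mono[of m j] Q(2)[of j] by blast
  qed
  have "disjoint_clopens X b"
    unfolding disjoint_clopens_def using P disj by (metis Int_commute linorder_neqE_nat)
  moreover have "strict_mono k"
    using Q(1) by (simp add: strict_mono_Suc_iff)
  ultimately show thesis
    using P that by blast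
qed

text \<open>Otherwise a subsequence has disjoint clopen neighbourhoods \<open>b i\<close>. Each
  \<open>s A\<close> is closed and contains infinitely many of its terms, hence the limit
  \<open>y\<close>. Two such suprema force \<open>y\<close> into some \<open>b n\<close>, which then
  contains a tail as well.\<close>

lemma convergent_sequence_hits_limit:
  assumes lim: "limitin X f y sequentially" and fX: "\<And>n. f n \<in> topspace X"
  shows "\<exists>n. f n = y"
proof (rule ccontr)
  assume ne: "\<nexists>n. f n = y"
  have yX: "y \<in> topspace X"
    using lim by (rule limitin_topspace)
  have ev: "eventually (\<lambda>n. f n \<in> W) sequentially" if "openin X W" "y \<in> W" for W
    using lim that by (simp add: limitin_def)
  have "infinite (range f)"
  proof
    assume "finite (range f)"
    then have "closedin X (range f)"
      using fX by (simp add: closedin_Hausdorff_finite[OF Hausdorff] image_subset_iff)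
    then have "eventually (\<lambda>n. f n \<in> topspace X - range f) sequentially"
      using ev[of "topspace X - range f"] ne yX by blast
    then show False
      by (auto simp: eventually_sequentially)
  qed
  then obtain k b where k: "strict_mono k" and b: "disjoint_clopens X b" and kb: "\<And>i. f (k i) \<in> b i"
    using disjoint_clopen_neighbourhoods[of f "\<lambda>_. topspace X"] fX by (metis openin_topspace)
  have ev': "\<exists>i0. \<forall>i\<ge>i0. f (k i) \<in> W" if W: "openin X W" "y \<in> W" for W
  proof -
    obtain n0 where "\<forall>n\<ge>n0. f n \<in> W"
      using ev[OF W] by (auto simp: eventually_sequentially)
    then show ?thesis
      using seq_suble[OF k] by (meson order_trans)
  qed
  obtain N :: "nat set \<Rightarrow> nat set" and s :: "nat set \<Rightarrow> 'a set"
    where N: "\<And>A. infinite (N A)" "\<And>A. openin X (s A)" "\<And>A. closedin X (s A)"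
      "\<And>A n. n \<in> N A \<Longrightarrow> b n \<subseteq> s A" "\<And>A B. A \<noteq> B \<Longrightarrow> s A \<inter> s B \<subseteq> (\<Union>n. b n)"
    using almost_disjoint_suprema[OF b] by metis
  have "y \<in> s A" for A :: "nat set"
  proof (rule ccontr)
    assume "y \<notin> s A"
    then obtain i0 where i0: "\<forall>i\<ge>i0. f (k i) \<in> topspace X - s A"
      using ev'[of "topspace X - s A"] N(3)[of A] yX by blast
    obtain i where "i \<ge> i0" "i \<in> N A"
      using N(1)[of A] by (meson finite_nat_set_iff_bounded not_le)
    then show False
      using i0 kb N(4) by blast
  qed
  then have "y \<in> (\<Union>n. b n)"
    using N(5)[of "{}" UNIV] by (metis IntI UNIV_I empty_iff subsetD)
  then obtain n where n: "y \<in> b n"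
    by blast
  then obtain i0 where i0: "\<forall>i\<ge>i0. f (k i) \<in> b n"
    using ev'[of "b n"] b by (auto simp: disjoint_clopens_def)
  \<comment> \<open>\<open>Suc n\<close> makes \<open>i\<close> differ from \<open>n\<close>, so one
    term lies in two disjoint sets.\<close>
  define i where "i = max i0 (Suc n)"
  have "f (k i) \<in> b n \<inter> b i" "i \<noteq> n"
    using i0 kb by (auto simp: i_def)
  then show False
    using b unfolding disjoint_clopens_def by (metis empty_iff)
qed

text \<open>The map \<open>s\<close> is injective: an accumulation point of terms with indices in
  \<open>N A\<close> lies in \<open>s A\<close> but outside all \<open>b n\<close>, whereas
  \<open>s A \<inter> s B\<close> is covered by them for \<open>A \<noteq> B\<close>.\<close>

lemma uncountable_clopens:
  assumes "infinite (topspace X)"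
  shows "uncountable {C. openin X C \<and> closedin X C}"
proof -
  obtain f :: "nat \<Rightarrow> 'a" where f: "inj f" "range f \<subseteq> topspace X"
    using assms infinite_countable_subset by blast
  obtain k b where b: "disjoint_clopens X b" and kb: "\<And>i. f (k i) \<in> b i"
    using disjoint_clopen_neighbourhoods[of f "\<lambda>_. topspace X"] f range_inj_infinite[OF f(1)]
    by (metis openin_topspace range_subsetD)
  obtain N :: "nat set \<Rightarrow> nat set" and s :: "nat set \<Rightarrow> 'a set"
    where N: "\<And>A. infinite (N A)" "\<And>A. openin X (s A)" "\<And>A. closedin X (s A)"
      "\<And>A n. n \<in> N A \<Longrightarrow> b n \<subseteq> s A" "\<And>A B. A \<noteq> B \<Longrightarrow> s A \<inter> s B \<subseteq> (\<Union>n. b n)"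
    using almost_disjoint_suprema[OF b] by metis
  have "s A \<noteq> s B" if "A \<noteq> B" for A B :: "nat set"
  proof
    assume eq: "s A = s B"
    obtain y where y: "y \<in> topspace X" "y \<notin> (\<Union>n. b n)"
        "\<And>W. openin X W \<Longrightarrow> y \<in> W \<Longrightarrow> \<exists>m\<in>N A. f (k m) \<in> W"
      by (rule accumulation_point[where x = "\<lambda>i. f (k i)", OF b kb N(1)]) blast
    have "y \<in> s A"
      using y(3)[of "topspace X - s A"] y(1) N(3)[of A] N(4)[of _ A] kb by blast
    then show False
      using N(5)[OF that] eq y(2) by blast
  qed
  then have "inj s"
    by (meson injI)
  then have "uncountable (range s)"
    using uncountable_nat_sets countable_image_inj_on by blast
  then show ?thesis
    using N by (metis (mono_tags, lifting) countable_subset image_subsetI mem_Collect_eq)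
qed

text \<open>The core of the argument, free of cardinals: countably many pairs \<open>(n, m)\<close>
  would have to distinguish uncountably many sets \<open>A\<close>.\<close>

theorem no_increasing_retractions:
  assumes cont: "\<And>n. continuous_map X X (r n)" and cont': "continuous_map X X r'"
    and lim: "\<And>y. y \<in> topspace X \<Longrightarrow> limitin X (\<lambda>n. r n y) (r' y) sequentially"
    and fix_mono: "\<And>m n y. y \<in> topspace X \<Longrightarrow> m \<le> n \<Longrightarrow> r n (r m y) = r m y"
    and x: "\<And>n. x n \<in> topspace X" "\<And>n. r n (x n) \<noteq> x n" "\<And>m n. m < n \<Longrightarrow> r n (x m) = x m"
      "\<And>n. r' (x n) = x n"
  shows False
proof -
  \<comment> \<open>Neighbourhoods are taken inside these open sets, so that \<open>b i\<close>
    contains no fixed point of \<open>r (k i)\<close>.\<close>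
  define V where "V n = {v \<in> topspace X. r n v \<noteq> v}" for n
  have closed_fix: "closedin X {v \<in> topspace X. g v = v}" if "continuous_map X X g" for g
    using closedin_continuous_maps_eq[OF Hausdorff that continuous_map_id] by simp
  have V: "openin X (V n)" for n
  proof -
    have "V n = topspace X - {v \<in> topspace X. r n v = v}"
      by (auto simp: V_def)
    then show ?thesis
      using closed_fix[OF cont[of n]] by auto
  qed
  have "inj x"
    by (metis injI linorder_neqE_nat x(2,3))
  then have "infinite (range x)"
    by (rule range_inj_infinite)
  then obtain k b where k: "strict_mono k" and b: "disjoint_clopens X b"
    and kb: "\<And>i. x (k i) \<in> b i" and bV: "\<And>i. b i \<subseteq> V (k i)"
    using disjoint_clopen_neighbourhoods[of x V] V x(1,2) unfolding V_def by blast
  obtain N :: "nat set \<Rightarrow> nat set" and s :: "nat set \<Rightarrow> 'a set"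
    where N: "\<And>A. infinite (N A)" "\<And>A. openin X (s A)" "\<And>A. closedin X (s A)"
      "\<And>A n. n \<in> N A \<Longrightarrow> b n \<subseteq> s A" "\<And>A B. A \<noteq> B \<Longrightarrow> s A \<inter> s B \<subseteq> (\<Union>n. b n)"
    using almost_disjoint_suprema[OF b] by metis
  have "\<exists>n m. r n (x m) \<in> s A - (\<Union>i. b i)" for A :: "nat set"
  proof -
    obtain y where y: "y \<in> topspace X" "y \<notin> (\<Union>n. b n)"
        "\<And>W. openin X W \<Longrightarrow> y \<in> W \<Longrightarrow> \<exists>m\<in>N A. x (k m) \<in> W"
      by (rule accumulation_point[where x = "\<lambda>i. x (k i)", OF b kb N(1)]) blast
    have yA: "y \<in> s A"
      using y(3)[of "topspace X - s A"] y(1) N(3)[of A] N(4)[of _ A] kb by blast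
    \<comment> \<open>The fixed points of \<open>r'\<close> form a closed set that contains all
      terms, hence also \<open>y\<close>.\<close>
    have "r' y = y"
      using y(3)[of "topspace X - {v \<in> topspace X. r' v = v}"] y(1) closed_fix[OF cont'] x(1,4)
      by blast
    then obtain n where n: "r n y = y"
      using convergent_sequence_hits_limit[OF lim[OF y(1)]] cont y(1)
      by (metis continuous_map_def PiE)
    \<comment> \<open>Only finitely many \<open>b i\<close> are removed, so \<open>W\<close> stays
      open; for \<open>i \<ge> n\<close> fixed points exclude \<open>b i\<close>.\<close>
    define W where "W = s A - (\<Union>i\<in>{..<n}. b i)"
    have W: "openin X W" "y \<in> W"
      unfolding W_def using N(2)[of A] b yA y(2)
      by (auto simp: disjoint_clopens_def intro!: openin_diff closedin_Union)
    have "openin X {v \<in> topspace X. r n v \<in> W}"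
      using cont W(1) by (rule openin_continuous_map_preimage)
    then obtain m where m: "r n (x (k m)) \<in> W"
      using y(3)[of "{v \<in> topspace X. r n v \<in> W}"] n W(2) y(1) by auto
    have "r n (x (k m)) \<notin> b i" for i
    proof (cases "i < n")
      case True
      then show ?thesis
        using m by (auto simp: W_def)
    next
      case False
      \<comment> \<open>Hence \<open>r (k i)\<close> fixes the image of \<open>r n\<close>, whereas
        it moves every point of \<open>b i\<close>.\<close>
      then have "n \<le> k i"
        using seq_suble[OF k, of i] by linarith
      then show ?thesis
        using fix_mono[OF x(1)] bV[of i] by (auto simp: V_def)
    qed
    with m show ?thesis
      by (auto simp: W_def)
  qed
  then obtain g h where gh: "\<And>A :: nat set. r (g A) (x (h A)) \<in> s A - (\<Union>i. b i)"
    by metis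
  \<comment> \<open>The sets \<open>s A - (\<Union>i. b i)\<close> are pairwise disjoint, so no pair
    can serve two of them.\<close>
  have "inj (\<lambda>A. (g A, h A))"
  proof (rule injI)
    fix A B assume "(g A, h A) = (g B, h B)"
    then show "A = B"
      using gh[of A] gh[of B] N(5)[of A B] by auto
  qed
  then have "countable (UNIV :: nat set set)"
    by (rule countableI')
  then show False
    using uncountable_nat_sets by blast
qed

end

section \<open>Stone spaces\<close>

lemma scp_space_homeomorphic:
  assumes "scp_space X" and hom: "X homeomorphic_space Y"
  shows "scp_space Y"
proof -
  interpret scp_space X
    by fact
  obtain f where f: "homeomorphic_map Y X f"
    using hom homeomorphic_space homeomorphic_space_sym by blast
  have inj: "inj_on f (topspace Y)" and img: "f ` topspace Y = topspace X"
    using f by (auto simp: homeomorphic_eq_everything_map)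
  note open_iff = homeomorphic_map_openness[OF f] and closed_iff = homeomorphic_map_closedness[OF f]
  have pull: "\<exists>C\<subseteq>topspace Y. f ` C = D" if "D \<subseteq> topspace X" for D
    using that img by (metis subset_imageE)
  show ?thesis
  proof
    show "compact_space Y"
      using compact hom homeomorphic_compact_space by blast
    show "Hausdorff_space Y"
      using Hausdorff hom homeomorphic_Hausdorff_space by blast
  next
    fix W y assume W: "openin Y W" "y \<in> W"
    then have WY: "W \<subseteq> topspace Y"
      by (simp add: openin_subset)
    then obtain D where D: "openin X D" "closedin X D" "f y \<in> D" "D \<subseteq> f ` W"
      using clopen_base[of "f ` W" "f y"] W open_iff by blast
    then obtain C where C: "C \<subseteq> topspace Y" "f ` C = D"
      using pull[OF openin_subset] by blast
    have "y \<in> C" "C \<subseteq> W"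
      using C D W WY inj_on_image_mem_iff[OF inj, of y C] inj_on_image_subset_iff[OF inj, of C W]
      by blast+
    then show "\<exists>C. openin Y C \<and> closedin Y C \<and> y \<in> C \<and> C \<subseteq> W"
      using C D open_iff closed_iff by blast
  next
    fix b :: "nat \<Rightarrow> 'b set"
    assume b: "\<And>n. openin Y (b n)" "\<And>n. closedin Y (b n)" "\<And>m n. m \<noteq> n \<Longrightarrow> b m \<inter> b n = {}"
    have bY: "b n \<subseteq> topspace Y" for n
      using b(1) by (simp add: openin_subset)
    have "\<exists>N s. infinite N \<and> openin X s \<and> closedin X s \<and> (\<forall>n\<in>N. f ` b n \<subseteq> s) \<and>
            (\<forall>c. openin X c \<longrightarrow> closedin X c \<longrightarrow> (\<forall>n\<in>N. c \<inter> f ` b n = {}) \<longrightarrow> c \<inter> s = {})"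
    proof (rule scp)
      show "openin X (f ` b n)" "closedin X (f ` b n)" for n
        using b open_iff closed_iff bY by auto
      show "f ` b m \<inter> f ` b n = {}" if "m \<noteq> n" for m n
        using b(3)[OF that] inj_on_image_Int[OF inj bY bY, of m n] by simp
    qed
    then obtain N s where N: "infinite N" "openin X s" "closedin X s" "\<forall>n\<in>N. f ` b n \<subseteq> s"
      "\<And>c. openin X c \<Longrightarrow> closedin X c \<Longrightarrow> \<forall>n\<in>N. c \<inter> f ` b n = {} \<Longrightarrow> c \<inter> s = {}"
      by blast
    obtain t where t: "t \<subseteq> topspace Y" "f ` t = s"
      using pull[OF openin_subset] N(2) by blast
    have "openin Y t" "closedin Y t"
      using N(2,3) t open_iff closed_iff by auto
    moreover have "b n \<subseteq> t" if "n \<in> N" for n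
      using N(4) that t bY by (metis inj_on_image_subset_iff[OF inj])
    moreover have "c \<inter> t = {}"
      if c: "openin Y c" "closedin Y c" "\<forall>n\<in>N. c \<inter> b n = {}" for c
    proof -
      have cY: "c \<subseteq> topspace Y"
        using c by (simp add: openin_subset)
      have "f ` c \<inter> f ` b n = {}" if "n \<in> N" for n
        using c(3) that inj_on_image_Int[OF inj cY bY, of n] by auto
      then have "f ` c \<inter> s = {}"
        using c cY open_iff closed_iff by (intro N(5)) auto
      then show ?thesis
        using inj_on_image_Int[OF inj cY t(1)] t(2) by auto
    qed
    ultimately show "\<exists>N s. infinite N \<and> openin Y s \<and> closedin Y s \<and> (\<forall>n\<in>N. b n \<subseteq> s) \<and>
        (\<forall>c. openin Y c \<longrightarrow> closedin Y c \<longrightarrow> (\<forall>n\<in>N. c \<inter> b n = {}) \<longrightarrow> c \<inter> s = {})"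
      using N(1) by blast
  qed
qed

section \<open>Ultrafilters and the Stone map\<close>

definition stone_set :: "'a::boolean_algebra \<Rightarrow> 'a set set" where
  "stone_set a = {U. ultrafilter U \<and> a \<in> U}"

lemma ultrafilterD:
  assumes "ultrafilter U"
  shows "top \<in> U" "bot \<notin> U" "a \<in> U \<Longrightarrow> b \<in> U \<Longrightarrow> inf a b \<in> U" "a \<in> U \<Longrightarrow> a \<le> b \<Longrightarrow> b \<in> U"
  using assms unfolding ultrafilter_def proper_filter_def by blast+

text \<open>If \<open>a\<close> is not in \<open>U\<close>, the filter generated by \<open>U\<close>
  and \<open>- a\<close> is proper, since \<open>inf u (- a) = bot\<close> would mean
  \<open>u \<le> a\<close>. Maximality then puts \<open>- a\<close> into \<open>U\<close>.\<close>

lemma ultrafilter_compl_iff: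
  assumes U: "ultrafilter U"
  shows "- a \<in> U \<longleftrightarrow> a \<notin> U"
proof
  assume "- a \<in> U"
  then show "a \<notin> U"
    using ultrafilterD[OF U] by (metis inf_compl_bot)
next
  assume a: "a \<notin> U"
  define F where "F = {x. \<exists>u\<in>U. inf u (- a) \<le> x}"
  have "proper_filter F"
    unfolding proper_filter_def
  proof (intro conjI ballI allI impI)
    show "top \<in> F"
      using ultrafilterD(1)[OF U] by (auto simp: F_def)
    show "bot \<notin> F"
    proof
      assume "bot \<in> F"
      then obtain u where "u \<in> U" "inf u (- a) \<le> bot"
        by (auto simp: F_def)
      then have "u \<le> a"
        by (simp add: inf_shunt bot_unique)
      then show False
        using a \<open>u \<in> U\<close> ultrafilterD(4)[OF U] by blast
    qed
    show "inf x y \<in> F" if xy: "x \<in> F" "y \<in> F" for x y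
    proof -
      obtain u v where u: "u \<in> U" "inf u (- a) \<le> x" and v: "v \<in> U" "inf v (- a) \<le> y"
        using xy by (auto simp: F_def)
      have "inf (inf u v) (- a) \<le> inf x y"
        using inf_mono[OF u(2) v(2)] by (simp add: ac_simps)
      then show ?thesis
        using ultrafilterD(3)[OF U u(1) v(1)] by (auto simp: F_def)
    qed
    show "y \<in> F" if "x \<in> F" "x \<le> y" for x y
      using that by (auto simp: F_def intro: order_trans)
  qed
  moreover have "U \<subseteq> F"
    by (auto simp: F_def intro: le_infI1)
  ultimately have "F = U"
    using U by (auto simp: ultrafilter_def)
  moreover have "- a \<in> F"
    using ultrafilterD(1)[OF U] by (auto simp: F_def intro: le_infI2)
  ultimately show "- a \<in> U"
    by simp
qed

text \<open>Zorn's lemma is applied to the proper filters containing \<open>a\<close>. A maximal one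
  is maximal among all proper filters, because extensions still contain \<open>a\<close>.\<close>

lemma ultrafilter_exists:
  fixes a :: "'a::boolean_algebra"
  assumes "a \<noteq> bot"
  shows "\<exists>U. ultrafilter U \<and> a \<in> U"
proof -
  let ?\<A> = "{F. proper_filter F \<and> a \<in> F}"
  have "\<exists>M\<in>?\<A>. \<forall>X\<in>?\<A>. M \<subseteq> X \<longrightarrow> X = M"
  proof (rule subset_Zorn_nonempty)
    have "proper_filter {x. a \<le> x}"
      using assms by (auto simp: proper_filter_def bot_unique intro: order_trans)
    then show "?\<A> \<noteq> {}"
      by blast
  next
    fix \<C> assume ne: "\<C> \<noteq> {}" and ch: "subset.chain ?\<A> \<C>"
    have mem: "proper_filter F" "a \<in> F" if "F \<in> \<C>" for F
      using ch that by (auto simp: subset.chain_def)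
    have "inf x y \<in> \<Union>\<C>" if xy: "x \<in> \<Union>\<C>" "y \<in> \<Union>\<C>" for x y
    proof -
      obtain F G where FG: "F \<in> \<C>" "x \<in> F" "G \<in> \<C>" "y \<in> G"
        using xy by blast
      then have "F \<subseteq> G \<or> G \<subseteq> F"
        using ch by (auto simp: subset_chain_def)
      then have "inf x y \<in> F \<or> inf x y \<in> G"
        using FG mem(1) unfolding proper_filter_def by (meson subsetD)
      then show ?thesis
        using FG by blast
    qed
    moreover have "y \<in> \<Union>\<C>" if "x \<in> \<Union>\<C>" "x \<le> y" for x y
      using that mem(1) unfolding proper_filter_def by blast
    ultimately have "proper_filter (\<Union>\<C>)"
      using mem(1) ne unfolding proper_filter_def by blast
    then show "\<Union>\<C> \<in> ?\<A>"
      using mem ne by blast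
  qed
  then show ?thesis
    unfolding ultrafilter_def by blast
qed

lemma stone_set_inf: "stone_set (inf a b) = stone_set a \<inter> stone_set b"
  unfolding stone_set_def using ultrafilterD(3,4) by (blast intro: inf_le1 inf_le2)

lemma stone_set_compl: "stone_set (- a) = stone_set top - stone_set a"
  unfolding stone_set_def using ultrafilter_compl_iff ultrafilterD(1) by blast

lemma stone_set_mono: "a \<le> b \<Longrightarrow> stone_set a \<subseteq> stone_set b"
  unfolding stone_set_def using ultrafilterD(4) by blast

lemma stone_set_sup: "stone_set (sup a b) = stone_set a \<union> stone_set b"
proof -
  have "stone_set (sup a b) = stone_set (- inf (- a) (- b))"
    by simp
  also have "\<dots> = stone_set a \<union> stone_set b"
    unfolding stone_set_compl stone_set_inf using stone_set_mono[OF top_greatest] by blast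
  finally show ?thesis .
qed

lemma stone_set_eq_empty: "stone_set a = {} \<longleftrightarrow> a = bot"
  using ultrafilter_exists[of a] ultrafilterD(2) by (auto simp: stone_set_def)

lemma inj_stone_set: "inj stone_set"
proof (rule injI)
  fix a b :: 'a assume eq: "stone_set a = stone_set b"
  have "stone_set (inf a (- b)) = {}" "stone_set (inf b (- a)) = {}"
    unfolding stone_set_inf stone_set_compl using eq by blast+
  then have "inf a (- b) = bot" "inf b (- a) = bot"
    by (simp_all add: stone_set_eq_empty)
  then show "a = b"
    by (simp add: inf_shunt order_antisym)
qed

section \<open>Topology of the Stone space\<close>

lemma topspace_stone_space: "topspace stone_space = stone_set top"
  unfolding stone_space_def topology_generated_by_topspace
  using ultrafilterD(1) by (fastforce simp: stone_set_def)

lemma openin_stone_set: "openin stone_space (stone_set a)"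
  unfolding stone_space_def stone_set_def by (intro topology_generated_by_Basis) blast

lemma closedin_stone_set: "closedin stone_space (stone_set a)"
  unfolding closedin_def topspace_stone_space stone_set_compl[symmetric]
  by (simp add: openin_stone_set stone_set_mono)

text \<open>The generating sets are closed under binary intersection, so the subbase is already a
  base.\<close>

lemma stone_base:
  assumes "openin stone_space W" "U \<in> W"
  shows "\<exists>a. U \<in> stone_set a \<and> stone_set a \<subseteq> W"
proof -
  have "generate_topology_on (range stone_set) W"
    using assms(1) by (simp add: stone_space_def stone_set_def openin_topology_generated_by_iff)
  then show ?thesis
    using assms(2)
  proof (induction arbitrary: U)
    case (Int W W')
    then obtain a a' where "U \<in> stone_set a" "stone_set a \<subseteq> W" "U \<in> stone_set a'" "stone_set a' \<subseteq> W'"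
      by (metis IntE)
    then have "U \<in> stone_set (inf a a')" "stone_set (inf a a') \<subseteq> W \<inter> W'"
      by (auto simp: stone_set_inf)
    then show ?case
      by blast
  next
    case (UN K)
    then show ?case
      by (meson UnionE Union_upper order_trans)
  qed auto
qed

text \<open>A clopen set is compact, hence a finite union of generating sets, and joins in the
  algebra turn that union into a single one.\<close>

lemma clopen_stone_set:
  assumes compact: "compact_space (stone_space :: 'a::boolean_algebra set topology)"
    and C: "openin stone_space C" "closedin stone_space C"
  shows "\<exists>a::'a. C = stone_set a"
proof -
  have "compactin stone_space C"
    using compact C(2) by (rule closedin_compact_space)
  moreover have "C \<subseteq> \<Union>(stone_set ` {a. stone_set a \<subseteq> C})"
    using stone_base[OF C(1)] by blast
  ultimately have "\<exists>\<F>. finite \<F> \<and> \<F> \<subseteq> stone_set ` {a. stone_set a \<subseteq> C} \<and> C \<subseteq> \<Union>\<F>"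
    by (intro compactinD) (auto simp: openin_stone_set)
  then obtain A where A: "finite A" "A \<subseteq> {a. stone_set a \<subseteq> C}" "C \<subseteq> \<Union>(stone_set ` A)"
    by (metis finite_subset_image)
  have "\<exists>c. stone_set c = \<Union>(stone_set ` A)"
    using \<open>finite A\<close>
  proof induction
    case empty
    then show ?case
      by (auto intro: exI[of _ bot] simp: stone_set_eq_empty)
  next
    case (insert a A)
    then show ?case
      by (metis Union_insert image_insert stone_set_sup)
  qed
  then obtain c where "stone_set c = \<Union>(stone_set ` A)"
    by blast
  with A(2,3) have "C = stone_set c"
    by auto
  then show ?thesis
    by blast
qed

text \<open>A clopen set that misses all \<open>b n\<close> with \<open>n \<in> N\<close> comes from
  some \<open>d\<close> with \<open>a n \<le> - d\<close>; the least upper bound is then below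
  \<open>- d\<close> too.\<close>

lemma scp_space_stone:
  assumes scp: "SCP TYPE('a::boolean_algebra)"
    and compact: "compact_space (stone_space :: 'a set topology)"
    and Hausdorff: "Hausdorff_space (stone_space :: 'a set topology)"
  shows "scp_space (stone_space :: 'a set topology)"
proof
  show "compact_space (stone_space :: 'a set topology)" "Hausdorff_space (stone_space :: 'a set topology)"
    by (fact compact Hausdorff)+
next
  fix W and U :: "'a set" assume "openin stone_space W" "U \<in> W"
  then show "\<exists>C. openin stone_space C \<and> closedin stone_space C \<and> U \<in> C \<and> C \<subseteq> W"
    by (meson stone_base openin_stone_set closedin_stone_set)
next
  fix b :: "nat \<Rightarrow> 'a set set"
  assume b: "\<And>n. openin stone_space (b n)" "\<And>n. closedin stone_space (b n)"
    "\<And>m n. m \<noteq> n \<Longrightarrow> b m \<inter> b n = {}"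
  have "\<forall>n. \<exists>a. b n = stone_set a"
    using clopen_stone_set[OF compact] b(1,2) by blast
  then obtain a :: "nat \<Rightarrow> 'a" where a: "\<And>n. b n = stone_set (a n)"
    by metis
  have "inf (a m) (a n) = bot" if "m \<noteq> n" for m n
    using b(3)[OF that] stone_set_eq_empty[of "inf (a m) (a n)"] by (simp add: a stone_set_inf)
  then obtain N s where N: "infinite N" and s: "isLub UNIV (a ` N) s"
    using scp unfolding SCP_def by metis
  have upper: "b n \<subseteq> stone_set s" if "n \<in> N" for n
    unfolding a using isLubD2[OF s] that by (intro stone_set_mono) auto
  have least: "c \<inter> stone_set s = {}"
    if c: "openin stone_space c" "closedin stone_space c" "\<forall>n\<in>N. c \<inter> b n = {}" for c
  proof -
    obtain d where d: "c = stone_set d"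
      using clopen_stone_set[OF compact c(1,2)] by blast
    have "a n \<le> - d" if "n \<in> N" for n
    proof -
      have "inf d (a n) = bot"
        using c(3) that stone_set_eq_empty[of "inf d (a n)"] by (simp add: d a stone_set_inf)
      then show ?thesis
        by (metis inf_commute inf_shunt)
    qed
    then have "s \<le> - d"
      by (intro isLub_le_isUb[OF s] isUbI setleI) auto
    then have "inf d s = bot"
      by (metis inf_commute inf_shunt)
    then show ?thesis
      by (metis d stone_set_eq_empty stone_set_inf)
  qed
  have sup: "\<forall>n\<in>N. b n \<subseteq> stone_set s"
    "\<forall>c. openin stone_space c \<longrightarrow> closedin stone_space c \<longrightarrow> (\<forall>n\<in>N. c \<inter> b n = {}) \<longrightarrow> c \<inter> stone_set s = {}"
    using upper least by blast+
  show "\<exists>N s. infinite N \<and> openin stone_space s \<and> closedin stone_space s \<and> (\<forall>n\<in>N. b n \<subseteq> s) \<and>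
      (\<forall>c. openin stone_space c \<longrightarrow> closedin stone_space c \<longrightarrow> (\<forall>n\<in>N. c \<inter> b n = {}) \<longrightarrow> c \<inter> s = {})"
    by (rule exI[of _ N], rule exI[of _ "stone_set s"])
      (intro conjI N openin_stone_set closedin_stone_set sup)
qed

lemma infinite_stone_space:
  assumes "infinite (UNIV :: 'a::boolean_algebra set)"
  shows "infinite (topspace (stone_space :: 'a set topology))"
proof
  assume "finite (topspace (stone_space :: 'a set topology))"
  moreover have "range stone_set \<subseteq> Pow (topspace (stone_space :: 'a set topology))"
    using stone_set_mono[OF top_greatest] by (auto simp: topspace_stone_space)
  ultimately have "finite (range (stone_set :: 'a \<Rightarrow> _))"
    by (meson finite_Pow_iff finite_subset)
  then show False
    using assms inj_stone_set finite_imageD by blast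
qed

lemma clopens_stone_space:
  assumes "compact_space (stone_space :: 'a::boolean_algebra set topology)"
  shows "{C. openin stone_space C \<and> closedin stone_space C} = range (stone_set :: 'a \<Rightarrow> _)"
  using clopen_stone_set[OF assms] openin_stone_set closedin_stone_set by blast

section \<open>Compact subsets of Sigma-products\<close>

text \<open>Sets of cardinality below \<open>\<kappa>\<close> are called small. Regularity makes
  small unions of small sets small; uncountability admits constructions in countably many
  stages.\<close>

locale uncountable_regular =
  fixes \<kappa> :: "'k rel"
  assumes Cinf: "Cinfinite \<kappa>" and regular: "regularCard \<kappa>"
    and nat_small: "|UNIV :: nat set| <o \<kappa>"
begin

section \<open>Arithmetic of small sets\<close>

lemma small_subset: "A \<subseteq> B \<Longrightarrow> |B| <o \<kappa> \<Longrightarrow> |A| <o \<kappa>"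
  using card_of_mono1 ordLeq_ordLess_trans by blast

lemma small_image: "|A| <o \<kappa> \<Longrightarrow> |f ` A| <o \<kappa>"
  using card_of_image ordLeq_ordLess_trans by blast

lemma small_UN: "|I| <o \<kappa> \<Longrightarrow> (\<And>i. i \<in> I \<Longrightarrow> |A i| <o \<kappa>) \<Longrightarrow> |\<Union>i\<in>I. A i| <o \<kappa>"
  using card_of_UNION_ordLess_infinite_Field_regularCard[OF regular Cinf] by blast

lemma small_Un: "|A| <o \<kappa> \<Longrightarrow> |B| <o \<kappa> \<Longrightarrow> |A \<union> B| <o \<kappa>"
  using card_of_Un_ordLess_infinite_Field Cinf unfolding cinfinite_def by blast

lemma small_countable: "countable A \<Longrightarrow> |A| <o \<kappa>"
proof -
  assume "countable A"
  then obtain f :: "'a \<Rightarrow> nat" where "inj_on f A"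
    by (auto simp: countable_def)
  then have "|A| \<le>o |UNIV :: nat set|"
    using card_of_ordLeq[of A "UNIV :: nat set"] by blast
  then show ?thesis
    using nat_small by (rule ordLeq_ordLess_trans)
qed

lemma small_Times:
  assumes "|A| <o \<kappa>" "|B| <o \<kappa>"
  shows "|A \<times> B| <o \<kappa>"
proof -
  have "A \<times> B = (\<Union>a\<in>A. Pair a ` B)"
    by blast
  then show ?thesis
    using assms by (simp add: small_UN small_image)
qed

text \<open>Induction handles each fixed length; \<open>nat_small\<close> then permits the union
  over all lengths.\<close>

lemma small_lists:
  assumes "|A| <o \<kappa>"
  shows "|lists A| <o \<kappa>"
proof -
  have "|{xs. length xs = n \<and> set xs \<subseteq> A}| <o \<kappa>" for n
  proof (induction n)
    case 0
    have "{xs. length xs = 0 \<and> set xs \<subseteq> A} = {[]}"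
      by auto
    then show ?case
      by (simp only: small_countable countable_finite finite.intros)
  next
    case (Suc n)
    have "{xs. length xs = Suc n \<and> set xs \<subseteq> A} = (\<Union>a\<in>A. Cons a ` {xs. length xs = n \<and> set xs \<subseteq> A})"
      by (auto simp: length_Suc_conv)
    then show ?case
      using assms Suc by (simp only: small_UN small_image)
  qed
  then have "|\<Union>n::nat. {xs. length xs = n \<and> set xs \<subseteq> A}| <o \<kappa>"
    using nat_small by (intro small_UN) auto
  moreover have "lists A = (\<Union>n. {xs. length xs = n \<and> set xs \<subseteq> A})"
    by (auto simp: in_lists_conv_set)
  ultimately show ?thesis
    by simp
qed

end

section \<open>Basic open boxes with rational bounds\<close>

definition cylinder :: "('g \<times> real \<times> real) list \<Rightarrow> ('g \<Rightarrow> real) set" where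
  "cylinder l = {y. \<forall>(\<gamma>, p, q)\<in>set l. p < y \<gamma> \<and> y \<gamma> < q}"

text \<open>Codes make boxes countable by cardinality: with rational bounds, a small set of
  coordinates has a small set of codes.\<close>

definition codes :: "'g set \<Rightarrow> ('g \<times> real \<times> real) list set" where
  "codes \<Delta> = lists (\<Delta> \<times> \<rat> \<times> \<rat>)"

lemma cylinderI: "(\<And>\<gamma> p q. (\<gamma>, p, q) \<in> set l \<Longrightarrow> p < y \<gamma> \<and> y \<gamma> < q) \<Longrightarrow> y \<in> cylinder l"
  by (auto simp: cylinder_def)

lemma cylinderD: "y \<in> cylinder l \<Longrightarrow> (\<gamma>, p, q) \<in> set l \<Longrightarrow> p < y \<gamma> \<and> y \<gamma> < q"
  by (auto simp: cylinder_def)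

lemma codesD: "l \<in> codes \<Delta> \<Longrightarrow> (\<gamma>, p, q) \<in> set l \<Longrightarrow> \<gamma> \<in> \<Delta>"
  by (auto simp: codes_def)

lemma openin_cylinder:
  assumes "l \<in> codes \<Gamma>"
  shows "openin (product_topology (\<lambda>_. euclideanreal) \<Gamma>) (topspace (product_topology (\<lambda>_. euclideanreal) \<Gamma>) \<inter> cylinder l)"
proof -
  let ?P = "product_topology (\<lambda>_::'a. euclideanreal) \<Gamma>"
  show ?thesis
    using assms unfolding codes_def
  proof (induction rule: lists.induct)
    case Nil
    then show ?case
      by (simp add: cylinder_def del: topspace_product_topology)
  next
    case (Cons a l)
    obtain \<gamma> p q where a: "a = (\<gamma>, p, q)"
      by (rule prod_cases3)
    have 1: "openin ?P {y \<in> topspace ?P. y \<gamma> \<in> {p<..<q}}"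
      using Cons.hyps(1) a
      by (intro openin_continuous_map_preimage[OF continuous_map_product_projection]) auto
    have 2: "topspace ?P \<inter> cylinder (a # l) = {y \<in> topspace ?P. y \<gamma> \<in> {p<..<q}} \<inter> (topspace ?P \<inter> cylinder l)"
      by (auto simp: cylinder_def a)
    show ?case
      unfolding 2 using 1 Cons.IH by (rule openin_Int)
  qed
qed

lemma cylinder_base:
  assumes W: "openin (product_topology (\<lambda>_. euclideanreal) \<Gamma>) W" "x \<in> W"
  shows "\<exists>l \<in> codes \<Gamma>. x \<in> cylinder l \<and> (\<Gamma> \<rightarrow>\<^sub>E UNIV) \<inter> cylinder l \<subseteq> W"
proof -
  obtain U where U: "finite {i \<in> \<Gamma>. U i \<noteq> (UNIV :: real set)}" "\<And>i. i \<in> \<Gamma> \<Longrightarrow> open (U i)"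
      "x \<in> Pi\<^sub>E \<Gamma> U" "Pi\<^sub>E \<Gamma> U \<subseteq> W"
    using W unfolding openin_product_topology_alt by fastforce
  have "\<exists>p q. p \<in> \<rat> \<and> q \<in> \<rat> \<and> p < x i \<and> x i < q \<and> {p<..<q} \<subseteq> U i" if i: "i \<in> \<Gamma>" for i
  proof -
    obtain e where e: "e > 0" "ball (x i) e \<subseteq> U i"
      using U(2)[OF i] U(3) i by (meson PiE_mem open_contains_ball)
    obtain p where p: "p \<in> \<rat>" "x i - e < p" "p < x i"
      using Rats_dense_in_real[of "x i - e" "x i"] e(1) by auto
    obtain q where q: "q \<in> \<rat>" "x i < q" "q < x i + e"
      using Rats_dense_in_real[of "x i" "x i + e"] e(1) by auto
    have "{p<..<q} \<subseteq> ball (x i) e"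
      using p q by (auto simp: dist_real_def)
    then show ?thesis
      using p q e(2) by blast
  qed
  then obtain p q where pq: "\<And>i. i \<in> \<Gamma> \<Longrightarrow> p i \<in> \<rat> \<and> q i \<in> \<rat> \<and> p i < x i \<and> x i < q i \<and> {p i<..<q i} \<subseteq> U i"
    by metis
  obtain js where js: "set js = {i \<in> \<Gamma>. U i \<noteq> UNIV}"
    using finite_list[OF U(1)] by blast
  define l where "l = map (\<lambda>i. (i, p i, q i)) js"
  have "l \<in> codes \<Gamma>"
    using js pq by (auto simp: l_def codes_def)
  moreover have "x \<in> cylinder l"
    using js pq by (auto simp: l_def cylinder_def)
  moreover have "y \<in> W" if y: "y \<in> \<Gamma> \<rightarrow>\<^sub>E UNIV" "y \<in> cylinder l" for y
  proof -
    have "y i \<in> U i" if i: "i \<in> \<Gamma>" for i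
    proof (cases "U i = UNIV")
      case False
      then have "p i < y i \<and> y i < q i"
        using y(2) js i by (auto simp: l_def cylinder_def)
      then show ?thesis
        using pq[OF i] by auto
    qed simp
    then have "y \<in> Pi\<^sub>E \<Gamma> U"
      using y(1) by (simp add: PiE_iff)
    then show ?thesis
      using U(4) by blast
  qed
  ultimately show ?thesis
    by blast
qed

section \<open>Supports and coordinate retractions\<close>

definition supp :: "'g set \<Rightarrow> ('g \<Rightarrow> real) \<Rightarrow> 'g set" where
  "supp \<Gamma> x = {\<gamma> \<in> \<Gamma>. x \<gamma> \<noteq> 0}"

text \<open>Outside \<open>\<Gamma>\<close> the value is \<open>undefined\<close> and not 0, which
  keeps the result in the extensional product.\<close>

definition cut :: "'g set \<Rightarrow> 'g set \<Rightarrow> ('g \<Rightarrow> real) \<Rightarrow> 'g \<Rightarrow> real" where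
  "cut \<Gamma> \<Delta> x = (\<lambda>\<gamma>\<in>\<Gamma>. if \<gamma> \<in> \<Delta> then x \<gamma> else 0)"

lemma cut_eq_iff:
  assumes "x \<in> \<Gamma> \<rightarrow>\<^sub>E UNIV"
  shows "cut \<Gamma> \<Delta> x = x \<longleftrightarrow> supp \<Gamma> x \<subseteq> \<Delta>"
proof
  assume eq: "cut \<Gamma> \<Delta> x = x"
  show "supp \<Gamma> x \<subseteq> \<Delta>"
  proof
    fix \<gamma> assume "\<gamma> \<in> supp \<Gamma> x"
    then show "\<gamma> \<in> \<Delta>"
      using fun_cong[OF eq, of \<gamma>] by (auto simp: cut_def supp_def split: if_splits)
  qed
next
  assume "supp \<Gamma> x \<subseteq> \<Delta>"
  then show "cut \<Gamma> \<Delta> x = x"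
    using assms by (auto simp: fun_eq_iff cut_def supp_def PiE_iff extensional_def)
qed

lemma cut_cut: "\<Delta> \<subseteq> \<Delta>' \<Longrightarrow> cut \<Gamma> \<Delta>' (cut \<Gamma> \<Delta> x) = cut \<Gamma> \<Delta> x"
  by (auto simp: cut_def fun_eq_iff)

lemma cut_PiE: "cut \<Gamma> \<Delta> x \<in> \<Gamma> \<rightarrow>\<^sub>E UNIV"
  by (simp add: cut_def)

lemma continuous_map_cut:
  "continuous_map (product_topology (\<lambda>_. euclideanreal) \<Gamma>) (product_topology (\<lambda>_. euclideanreal) \<Gamma>) (cut \<Gamma> \<Delta>)"
  unfolding continuous_map_componentwise
proof (intro conjI ballI)
  show "cut \<Gamma> \<Delta> ` topspace (product_topology (\<lambda>_. euclideanreal) \<Gamma>) \<subseteq> extensional \<Gamma>"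
    by (auto simp: cut_def)
  show "continuous_map (product_topology (\<lambda>_. euclideanreal) \<Gamma>) euclideanreal (\<lambda>x. cut \<Gamma> \<Delta> x \<gamma>)"
    if "\<gamma> \<in> \<Gamma>" for \<gamma>
  proof (cases "\<gamma> \<in> \<Delta>")
    case True
    then have "(\<lambda>x. cut \<Gamma> \<Delta> x \<gamma>) = (\<lambda>x. x \<gamma>)"
      using that by (simp add: cut_def)
    then show ?thesis
      using continuous_map_product_projection[OF that, of "\<lambda>_. euclideanreal"] by simp
  qed (use that in \<open>simp add: cut_def\<close>)
qed

text \<open>Each coordinate is eventually constant along the sequence.\<close>

lemma limitin_cut_Union:
  assumes "mono \<Delta>"
  shows "limitin (product_topology (\<lambda>_. euclideanreal) \<Gamma>) (\<lambda>n. cut \<Gamma> (\<Delta> n) x) (cut \<Gamma> (\<Union>n. \<Delta> n) x) sequentially"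
  unfolding limitin_componentwise
proof (intro conjI ballI)
  show "cut \<Gamma> (\<Union>n. \<Delta> n) x \<in> extensional \<Gamma>"
    by (simp add: cut_def)
  show "\<forall>\<^sub>F n in sequentially. cut \<Gamma> (\<Delta> n) x \<in> topspace (product_topology (\<lambda>_. euclideanreal) \<Gamma>)"
    by (simp add: cut_PiE)
  fix \<gamma> assume \<gamma>: "\<gamma> \<in> \<Gamma>"
  have "\<forall>\<^sub>F n in sequentially. cut \<Gamma> (\<Delta> n) x \<gamma> = cut \<Gamma> (\<Union>n. \<Delta> n) x \<gamma>"
  proof (cases "\<gamma> \<in> (\<Union>n. \<Delta> n)")
    case True
    then obtain m where "\<gamma> \<in> \<Delta> m"
      by blast
    then have "\<gamma> \<in> \<Delta> n" if "n \<ge> m" for n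
      using monoD[OF assms that] by blast
    then show ?thesis
      using True \<gamma> by (auto simp: eventually_sequentially cut_def)
  next
    case False
    then show ?thesis
      by (simp add: cut_def)
  qed
  then show "limitin euclideanreal (\<lambda>n. cut \<Gamma> (\<Delta> n) x \<gamma>) (cut \<Gamma> (\<Union>n. \<Delta> n) x \<gamma>) sequentially"
    by (simp add: tendsto_eventually)
qed

section \<open>Compact subsets of a Sigma-product and their clopen sets\<close>

locale Sigma_compact = uncountable_regular \<kappa> for \<kappa> :: "'k rel" +
  fixes \<Gamma> :: "'g set" and S :: "('g \<Rightarrow> real) set"
  assumes S_Sigma: "S \<subseteq> Sigma_set \<kappa> \<Gamma>"
    and S_compact: "compactin (product_topology (\<lambda>_. euclideanreal) \<Gamma>) S"
begin

abbreviation "P \<equiv> product_topology (\<lambda>_::'g. euclideanreal) \<Gamma>"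

lemma S_PiE: "x \<in> S \<Longrightarrow> x \<in> \<Gamma> \<rightarrow>\<^sub>E UNIV"
  using S_Sigma by (auto simp: Sigma_set_def)

lemma small_supp: "x \<in> S \<Longrightarrow> |supp \<Gamma> x| <o \<kappa>"
  using S_Sigma by (auto simp: Sigma_set_def supp_def)

lemma small_codes: "|\<Delta>| <o \<kappa> \<Longrightarrow> |codes \<Delta>| <o \<kappa>"
  by (simp add: codes_def small_lists small_Times small_countable countable_rat)

lemma closedin_S: "closedin P S"
  using S_compact by (intro compactin_imp_closedin) (simp_all add: Hausdorff_space_product_topology)

text \<open>A Loewenheim-Skolem closure: a point of \<open>S\<close> is picked from each box that
  meets \<open>S\<close> and is coded over the current coordinates, its support is added, and this
  is repeated countably often.\<close>

lemma closing_off: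
  assumes \<Delta>: "\<Delta> \<subseteq> \<Gamma>" "|\<Delta>| <o \<kappa>"
  shows "\<exists>\<Delta>'. \<Delta> \<subseteq> \<Delta>' \<and> \<Delta>' \<subseteq> \<Gamma> \<and> |\<Delta>'| <o \<kappa> \<and> (\<forall>x\<in>S. cut \<Gamma> \<Delta>' x \<in> S)"
proof -
  define pick where "pick l = (SOME x. x \<in> S \<inter> cylinder l)" for l :: "('g \<times> real \<times> real) list"
  have pick: "pick l \<in> S \<inter> cylinder l" if "S \<inter> cylinder l \<noteq> {}" for l
    unfolding pick_def using that some_in_eq by blast
  define step where "step A = A \<union> (\<Union>l\<in>{l \<in> codes A. S \<inter> cylinder l \<noteq> {}}. supp \<Gamma> (pick l))" for A
  define D where "D n = (step ^^ n) \<Delta>" for n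
  have D_Suc: "D (Suc n) = step (D n)" for n
    by (simp add: D_def)
  have D: "D n \<subseteq> \<Gamma> \<and> |D n| <o \<kappa>" for n
  proof (induction n)
    case 0
    then show ?case
      using \<Delta> by (simp add: D_def)
  next
    case (Suc n)
    have "|{l \<in> codes (D n). S \<inter> cylinder l \<noteq> {}}| <o \<kappa>"
      using small_subset[OF _ small_codes] Suc by (metis (no_types, lifting) mem_Collect_eq subsetI)
    then have "|step (D n)| <o \<kappa>"
      unfolding step_def using Suc pick by (intro small_Un small_UN small_supp) auto
    moreover have "step (D n) \<subseteq> \<Gamma>"
      using Suc by (auto simp: step_def supp_def)
    ultimately show ?case
      by (simp add: D_Suc)
  qed
  have mono: "mono D"
    unfolding mono_iff_le_Suc by (auto simp: D_Suc step_def)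
  let ?\<Delta>' = "\<Union>n. D n"
  \<comment> \<open>\<open>cut \<Gamma> ?\<Delta>' x\<close> is a limit of picked points: they approximate \<open>x\<close> on \<open>?\<Delta>'\<close> and vanish elsewhere.\<close>
  have "cut \<Gamma> ?\<Delta>' x \<in> S" if x: "x \<in> S" for x
  proof (rule ccontr)
    assume "cut \<Gamma> ?\<Delta>' x \<notin> S"
    then have "cut \<Gamma> ?\<Delta>' x \<in> topspace P - S"
      using cut_PiE by simp
    then obtain l where l: "l \<in> codes \<Gamma>" "cut \<Gamma> ?\<Delta>' x \<in> cylinder l" "(\<Gamma> \<rightarrow>\<^sub>E UNIV) \<inter> cylinder l \<subseteq> topspace P - S"
      using cylinder_base[of \<Gamma> "topspace P - S" "cut \<Gamma> ?\<Delta>' x"] closedin_S by blast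
    \<comment> \<open>On the coordinates kept here \<open>x\<close> agrees with its cut, so
      \<open>x\<close> lies in the larger box.\<close>
    define l' where "l' = filter (\<lambda>t. fst t \<in> ?\<Delta>') l"
    have "finite (fst ` set l')" "fst ` set l' \<subseteq> \<Union>(range D)"
      by (auto simp: l'_def)
    \<comment> \<open>The stages form a chain, so one of them contains the finitely many coordinates
      of \<open>l'\<close>.\<close>
    moreover have "D m \<subseteq> D n \<or> D n \<subseteq> D m" for m n
      using monoD[OF mono] nat_le_linear by blast
    then have "subset.chain UNIV (range D)"
      by (auto simp: subset_chain_def)
    ultimately obtain A where "A \<in> range D" "fst ` set l' \<subseteq> A"
      using finite_subset_Union_chain[of "fst ` set l'" "range D"] by blast
    then obtain n where n: "fst ` set l' \<subseteq> D n"
      by blast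
    have l'_codes: "l' \<in> codes (D n)"
      using l(1) n by (fastforce simp: codes_def l'_def)
    have "x \<in> cylinder l'"
    proof (rule cylinderI)
      fix \<gamma> p q assume "(\<gamma>, p, q) \<in> set l'"
      then have t: "(\<gamma>, p, q) \<in> set l" "\<gamma> \<in> ?\<Delta>'"
        by (auto simp: l'_def)
      then have "cut \<Gamma> ?\<Delta>' x \<gamma> = x \<gamma>"
        using codesD[OF l(1)] by (simp add: cut_def)
      then show "p < x \<gamma> \<and> x \<gamma> < q"
        using cylinderD[OF l(2) t(1)] by simp
    qed
    then have ne: "S \<inter> cylinder l' \<noteq> {}"
      using x by blast
    define d where "d = pick l'"
    have d: "d \<in> S" "d \<in> cylinder l'"
      using pick[OF ne] by (auto simp: d_def)
    \<comment> \<open>The support of the picked point was added at the next stage, so outside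
      \<open>?\<Delta>'\<close> both \<open>d\<close> and the cut of \<open>x\<close>
      vanish.\<close>
    have "supp \<Gamma> d \<subseteq> D (Suc n)"
      using l'_codes ne by (auto simp: D_Suc step_def d_def)
    then have supp: "supp \<Gamma> d \<subseteq> ?\<Delta>'"
      by blast
    have "p < d \<gamma> \<and> d \<gamma> < q" if t: "(\<gamma>, p, q) \<in> set l" for \<gamma> p q
    proof (cases "\<gamma> \<in> ?\<Delta>'")
      case True
      then show ?thesis
        using t by (intro cylinderD[OF d(2)]) (simp add: l'_def)
    next
      case False
      moreover have "\<gamma> \<in> \<Gamma>"
        using l(1) t by (rule codesD)
      ultimately have "d \<gamma> = cut \<Gamma> ?\<Delta>' x \<gamma>"
        using supp by (auto simp: supp_def cut_def)
      then show ?thesis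
        using cylinderD[OF l(2) t] by simp
    qed
    then have "d \<in> cylinder l"
      by (rule cylinderI)
    then show False
      using l(3) d(1) S_PiE by blast
  qed
  moreover have "|?\<Delta>'| <o \<kappa>"
    using D nat_small by (intro small_UN) auto
  moreover have "\<Delta> \<subseteq> ?\<Delta>'"
    using D_def[of 0] by auto
  ultimately show ?thesis
    using D by (intro exI[of _ ?\<Delta>']) blast
qed

text \<open>By compactness a clopen set is a finite union of boxes over
  \<open>\<Gamma> \<inter> \<Delta>\<close>, hence is named by a list of codes, and there are few
  such lists.\<close>

lemma few_clopens:
  assumes \<Delta>: "|\<Delta>| <o \<kappa>" and supp: "\<And>x. x \<in> S \<Longrightarrow> supp \<Gamma> x \<subseteq> \<Delta>"
  shows "|{C. openin (subtopology P S) C \<and> closedin (subtopology P S) C}| <o \<kappa>"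
proof -
  let ?\<L> = "codes (\<Gamma> \<inter> \<Delta>)"
  have "\<exists>L \<in> lists ?\<L>. C = (\<Union>l\<in>set L. S \<inter> cylinder l)"
    if C: "openin (subtopology P S) C" "closedin (subtopology P S) C" for C
  proof -
    obtain W where W: "openin P W" "C = W \<inter> S"
      using C(1) by (auto simp: openin_subtopology)
    have base: "\<exists>l\<in>?\<L>. x \<in> cylinder l \<and> S \<inter> cylinder l \<subseteq> C" if x: "x \<in> C" for x
    proof -
      obtain l where l: "l \<in> codes \<Gamma>" "x \<in> cylinder l" "(\<Gamma> \<rightarrow>\<^sub>E UNIV) \<inter> cylinder l \<subseteq> W"
        using cylinder_base[OF W(1), of x] W(2) x by blast
      \<comment> \<open>The dropped constraints hold at \<open>x\<close>, and all points of
        \<open>S\<close> share the value 0 at those coordinates.\<close>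
      define l' where "l' = filter (\<lambda>t. fst t \<in> \<Delta>) l"
      have "l' \<in> ?\<L>"
        using l(1) by (fastforce simp: codes_def l'_def)
      moreover have "x \<in> cylinder l'"
        using l(2) by (auto simp: cylinder_def l'_def)
      moreover have "y \<in> cylinder l" if y: "y \<in> S" "y \<in> cylinder l'" for y
      proof -
        have "p < y \<gamma> \<and> y \<gamma> < q" if t: "(\<gamma>, p, q) \<in> set l" for \<gamma> p q
        proof (cases "\<gamma> \<in> \<Delta>")
          case True
          then show ?thesis
            using t by (intro cylinderD[OF y(2)]) (simp add: l'_def)
        next
          case False
          moreover have "\<gamma> \<in> \<Gamma>"
            using l(1) t by (rule codesD)
          moreover have "\<gamma> \<notin> supp \<Gamma> y" "\<gamma> \<notin> supp \<Gamma> x"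
            using False supp[OF y(1)] supp[of x] x W(2) by blast+
          ultimately have "y \<gamma> = x \<gamma>"
            by (simp add: supp_def)
          then show ?thesis
            using cylinderD[OF l(2) t] by simp
        qed
        then show ?thesis
          by (rule cylinderI)
      qed
      ultimately show ?thesis
        using l(3) W(2) S_PiE by blast
    qed
    have "compact_space (subtopology P S)"
      using S_compact by (simp add: compact_space_subtopology)
    then have "compactin (subtopology P S) C"
      using C(2) by (rule closedin_compact_space)
    then have "compactin P C"
      by (simp add: compactin_subtopology)
    moreover have "C \<subseteq> \<Union>((\<lambda>l. topspace P \<inter> cylinder l) ` {l \<in> ?\<L>. S \<inter> cylinder l \<subseteq> C})"
      using base W(2) S_PiE by fastforce
    moreover have "openin P (topspace P \<inter> cylinder l)" if "l \<in> ?\<L>" for l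
      using that by (intro openin_cylinder) (auto simp: codes_def)
    ultimately obtain \<F> where \<F>: "finite \<F>" "\<F> \<subseteq> (\<lambda>l. topspace P \<inter> cylinder l) ` {l \<in> ?\<L>. S \<inter> cylinder l \<subseteq> C}"
        "C \<subseteq> \<Union>\<F>"
      using compactinD[of P C "(\<lambda>l. topspace P \<inter> cylinder l) ` {l \<in> ?\<L>. S \<inter> cylinder l \<subseteq> C}"] by blast
    obtain F where F: "finite F" "F \<subseteq> {l \<in> ?\<L>. S \<inter> cylinder l \<subseteq> C}"
        "\<F> = (\<lambda>l. topspace P \<inter> cylinder l) ` F"
      using finite_subset_image[OF \<F>(1,2)] by blast
    have "C \<subseteq> (\<Union>l\<in>F. topspace P \<inter> cylinder l)"
      using \<F>(3) F(3) by simp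
    then have "C \<subseteq> (\<Union>l\<in>F. S \<inter> cylinder l)"
      using W(2) by auto
    then have eq: "C = (\<Union>l\<in>F. S \<inter> cylinder l)"
      using F(2) by auto
    obtain L where L: "set L = F"
      using finite_list[OF F(1)] by blast
    have "C = (\<Union>l\<in>set L. S \<inter> cylinder l)"
      unfolding L by (rule eq)
    then show ?thesis
      using F(2) L by blast
  qed
  then have "{C. openin (subtopology P S) C \<and> closedin (subtopology P S) C} \<subseteq>
      (\<lambda>L. \<Union>l\<in>set L. S \<inter> cylinder l) ` lists ?\<L>"
    by blast
  moreover have "|\<Gamma> \<inter> \<Delta>| <o \<kappa>"
    using \<Delta> by (rule small_subset[rotated]) blast
  ultimately show ?thesis
    by (meson small_subset small_image small_lists small_codes)
qed

lemma not_scp_space: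
  assumes many: "\<not> |{C. openin (subtopology P S) C \<and> closedin (subtopology P S) C}| <o \<kappa>"
  shows "\<not> scp_space (subtopology P S)"
proof
  assume "scp_space (subtopology P S)"
  then interpret scp_space "subtopology P S" .
  have top: "topspace (subtopology P S) = S"
    using S_PiE by auto
  define good where "good \<Delta> \<longleftrightarrow> \<Delta> \<subseteq> \<Gamma> \<and> |\<Delta>| <o \<kappa> \<and> (\<forall>x\<in>S. cut \<Gamma> \<Delta> x \<in> S)" for \<Delta>
  define next' where "next' \<Delta> \<Delta>' \<longleftrightarrow> \<Delta> \<subseteq> \<Delta>' \<and> (\<exists>x\<in>S. supp \<Gamma> x \<subseteq> \<Delta>' \<and> \<not> supp \<Gamma> x \<subseteq> \<Delta>)" for \<Delta> \<Delta>'
  have "\<exists>\<Delta>'. good \<Delta>' \<and> next' \<Delta> \<Delta>'" if "good \<Delta>" for \<Delta>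
  proof -
    have \<Delta>: "\<Delta> \<subseteq> \<Gamma>" "|\<Delta>| <o \<kappa>"
      using that by (auto simp: good_def)
    \<comment> \<open>If \<open>\<Delta>\<close> contained all supports, there would be too few
      clopen sets.\<close>
    obtain x where x: "x \<in> S" "\<not> supp \<Gamma> x \<subseteq> \<Delta>"
      using few_clopens[OF \<Delta>(2)] many by blast
    have "\<Delta> \<union> supp \<Gamma> x \<subseteq> \<Gamma>" "|\<Delta> \<union> supp \<Gamma> x| <o \<kappa>"
      using \<Delta> small_Un small_supp[OF x(1)] by (auto simp: supp_def)
    then obtain \<Delta>' where "\<Delta> \<union> supp \<Gamma> x \<subseteq> \<Delta>'" "\<Delta>' \<subseteq> \<Gamma>" "|\<Delta>'| <o \<kappa>" "\<forall>x\<in>S. cut \<Gamma> \<Delta>' x \<in> S"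
      using closing_off by meson
    then show ?thesis
      using x unfolding good_def next'_def by blast
  qed
  moreover have "\<exists>\<Delta>. good \<Delta>"
    using closing_off[of "{}"] small_countable[of "{}"] unfolding good_def by auto
  ultimately have "\<exists>\<Delta>. \<forall>n. good (\<Delta> n) \<and> next' (\<Delta> n) (\<Delta> (Suc n))"
    by (intro dependent_nat_choice) blast+
  then obtain \<Delta> :: "nat \<Rightarrow> 'g set" where good: "\<And>n. good (\<Delta> n)" and nxt: "\<And>n. next' (\<Delta> n) (\<Delta> (Suc n))"
    by blast
  have mono: "mono \<Delta>"
    using nxt unfolding mono_iff_le_Suc next'_def by blast
  have "\<exists>x. \<forall>n. x n \<in> S \<and> supp \<Gamma> (x n) \<subseteq> \<Delta> (Suc n) \<and> \<not> supp \<Gamma> (x n) \<subseteq> \<Delta> n"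
    using nxt unfolding next'_def by meson
  then obtain x where x: "\<And>n. x n \<in> S" "\<And>n. supp \<Gamma> (x n) \<subseteq> \<Delta> (Suc n)" "\<And>n. \<not> supp \<Gamma> (x n) \<subseteq> \<Delta> n"
    by blast
  have cut_S: "cut \<Gamma> (\<Delta> n) y \<in> S" if "y \<in> S" for n y
    using good that by (simp add: good_def)
  \<comment> \<open>This cut is a limit of points of \<open>S\<close>, and \<open>S\<close> is
    closed.\<close>
  have cut'_S: "cut \<Gamma> (\<Union>n. \<Delta> n) y \<in> S" if "y \<in> S" for y
    using limitin_closedin[OF limitin_cut_Union[OF mono] closedin_S] cut_S[OF that] by simp
  have cont: "continuous_map (subtopology P S) (subtopology P S) (cut \<Gamma> A)" if "\<And>y. y \<in> S \<Longrightarrow> cut \<Gamma> A y \<in> S" for A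
    unfolding continuous_map_in_subtopology top
    using continuous_map_from_subtopology[OF continuous_map_cut] that by blast
  show False
  proof (rule no_increasing_retractions)
    show "continuous_map (subtopology P S) (subtopology P S) (cut \<Gamma> (\<Delta> n))" for n
      using cont cut_S by blast
    show "continuous_map (subtopology P S) (subtopology P S) (cut \<Gamma> (\<Union>n. \<Delta> n))"
      using cont cut'_S by blast
    show "limitin (subtopology P S) (\<lambda>n. cut \<Gamma> (\<Delta> n) y) (cut \<Gamma> (\<Union>n. \<Delta> n) y) sequentially"
      if "y \<in> topspace (subtopology P S)" for y
      using that limitin_cut_Union[OF mono] cut_S cut'_S unfolding limitin_subtopology top by simp
    show "cut \<Gamma> (\<Delta> n) (cut \<Gamma> (\<Delta> m) y) = cut \<Gamma> (\<Delta> m) y" if "m \<le> n" for m n y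
      using monoD[OF mono that] by (rule cut_cut)
    show "x n \<in> topspace (subtopology P S)" for n
      using x(1) top by simp
    show "cut \<Gamma> (\<Delta> n) (x n) \<noteq> x n" for n
      using cut_eq_iff[OF S_PiE[OF x(1)]] x(3) by blast
    \<comment> \<open>The support of \<open>x m\<close> lies in \<open>\<Delta> (Suc m)\<close>,
      which \<open>m < n\<close> places inside \<open>\<Delta> n\<close>.\<close>
    show "cut \<Gamma> (\<Delta> n) (x m) = x m" if "m < n" for m n
      using cut_eq_iff[OF S_PiE[OF x(1)]] x(2)[of m] monoD[OF mono Suc_leI[OF that]] by blast
    show "cut \<Gamma> (\<Union>n. \<Delta> n) (x n) = x n" for n
      using cut_eq_iff[OF S_PiE[OF x(1)]] x(2)[of n] by blast
  qed
qed

end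

theorem theorem10p3:
  fixes \<kappa> :: "'k rel"
  assumes "Cinfinite \<kappa>" and "regularCard \<kappa>"
    and "|UNIV :: 'a::boolean_algebra set| =o \<kappa>"
    and "SCP TYPE('a)"
  shows "\<not> Corson_algebra TYPE('g) \<kappa> TYPE('a)"
proof
  let ?X = "stone_space :: 'a set topology"
  assume "Corson_algebra TYPE('g) \<kappa> TYPE('a)"
  then obtain \<Gamma> :: "'g set" and S where compact: "compact_space ?X" and Hausdorff: "Hausdorff_space ?X"
    and S: "S \<subseteq> Sigma_set \<kappa> \<Gamma>" and hom: "?X homeomorphic_space subtopology (Sigma_space \<kappa> \<Gamma>) S"
    unfolding Corson_algebra_def Corson_compact_def by blast
  let ?P = "product_topology (\<lambda>_::'g. euclideanreal) \<Gamma>"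
  have "subtopology (Sigma_space \<kappa> \<Gamma>) S = subtopology ?P S"
    unfolding Sigma_space_def subtopology_subtopology using S by (simp add: inf_absorb2)
  with hom have hom: "?X homeomorphic_space subtopology ?P S"
    by simp
  interpret X: scp_space ?X
    using assms(4) compact Hausdorff by (rule scp_space_stone)
  have "infinite (Field \<kappa>)"
    using assms(1) by (simp add: cinfinite_def)
  then have inf: "infinite (UNIV :: 'a set)"
    using assms(1,3) card_of_ordIso_finite_Field ordIso_symmetric by blast
  \<comment> \<open>This excludes a countable \<open>\<kappa>\<close>, as the clopen sets correspond
    to the elements of the algebra.\<close>
  have "uncountable (range (stone_set :: 'a \<Rightarrow> _))"
    using X.uncountable_clopens[OF infinite_stone_space[OF inf]] clopens_stone_space[OF compact] by simp
  then have "\<nexists>f :: 'a \<Rightarrow> nat. inj f"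
    by (metis countableI' countable_image)
  then have "|UNIV :: nat set| <o |UNIV :: 'a set|"
    using card_of_ordLess[of "UNIV :: 'a set" "UNIV :: nat set"] by simp
  then have nat_small: "|UNIV :: nat set| <o \<kappa>"
    using assms(3) ordLess_ordIso_trans by blast
  interpret Sigma_compact \<kappa> \<Gamma> S
  proof
    have "compact_space (subtopology ?P S)"
      using compact hom homeomorphic_compact_space by blast
    moreover have "S \<subseteq> topspace ?P"
      using S by (auto simp: Sigma_set_def)
    ultimately show "compactin ?P S"
      by (simp add: compactin_subspace)
  qed (fact assms(1,2) nat_small S)+
  obtain f where f: "homeomorphic_map ?X (subtopology ?P S) f"
    using hom homeomorphic_space by blast
  \<comment> \<open>Embeds the algebra into the clopen subsets of \<open>S\<close>, of which there
    are thus at least \<open>\<kappa>\<close> many.\<close>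
  define c where "c a = f ` stone_set a" for a :: 'a
  have sub: "stone_set a \<subseteq> topspace ?X" for a :: 'a
    using stone_set_mono[OF top_greatest] by (simp add: topspace_stone_space)
  have "inj c"
  proof (rule injI)
    fix a b :: 'a assume "c a = c b"
    then have "stone_set a = stone_set b"
      using f sub unfolding c_def homeomorphic_eq_everything_map
      using inj_on_image_eq_iff by metis
    then show "a = b"
      by (rule injD[OF inj_stone_set])
  qed
  moreover have "range c \<subseteq> {C. openin (subtopology ?P S) C \<and> closedin (subtopology ?P S) C}"
    unfolding c_def using homeomorphic_map_openness[OF f sub] homeomorphic_map_closedness[OF f sub]
      openin_stone_set closedin_stone_set by auto
  ultimately have "|UNIV :: 'a set| \<le>o |{C. openin (subtopology ?P S) C \<and> closedin (subtopology ?P S) C}|"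
    using card_of_ordLeq by blast
  then have "\<not> |{C. openin (subtopology ?P S) C \<and> closedin (subtopology ?P S) C}| <o \<kappa>"
    using assms(3) by (metis not_ordLess_ordIso ordLeq_ordLess_trans)
  then have "\<not> scp_space (subtopology ?P S)"
    by (rule not_scp_space)
  then show False
    using scp_space_homeomorphic[OF X.scp_space_axioms hom] by blast
qed

end
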